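(* Let $G$ be a finite simple graph with no isolated vertices that is not isomorphic to any of the following graphs: (1) $K_{2,m}$ for some $m\ge 2$; (2) the wheel consisting of a $4$-cycle plus one vertex adjacent to all four cycle vertices; (3) $K_{2,2,2}$; (4) $2K_2$ (two disjoint edges); (5) the path $P_5$ on five vertices; (6) the graph with vertices $a,b,c,d,e$ and edges $ab,bc,ca,cd,de$ (a triangle with a path of length two attached at one vertex); (7) the bowtie (two triangles sharing exactly one vertex). Then $G$ is split if and only if $G/e$ is split for every edge $e\in E(G)$.
   Context: All graphs are finite and simple. A graph is split if its vertex set can be partitioned into a clique and an independent set. For an edge $e=uv$ of $G$, the contraction $G/e$ is obtained from $G$ by deleting $u$ and $v$ and adding a new vertex adjacent to every vertex of $(N(u)\cup N(v))\setminus\{u,v\}$. *)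

theory Defs
  imports "Graph_Theory.Graph_Theory"
begin

text \<open>
  A finite simple graph is a \<^locale>\<open>pair_graph\<close>: an undirected edge \<open>uv\<close> is represented by the
  two arcs \<open>(u, v)\<close> and \<open>(v, u)\<close>.
\<close>

definition nbrs :: "'a pair_pre_digraph \<Rightarrow> 'a \<Rightarrow> 'a set" where
  "nbrs G v = {w. (v, w) \<in> parcs G}"

definition no_isolated_vertices :: "'a pair_pre_digraph \<Rightarrow> bool" where
  "no_isolated_vertices G \<longleftrightarrow> (\<forall>v \<in> pverts G. nbrs G v \<noteq> {})"

definition clique_in :: "'a pair_pre_digraph \<Rightarrow> 'a set \<Rightarrow> bool" where
  "clique_in G K \<longleftrightarrow> K \<subseteq> pverts G \<and> (\<forall>x \<in> K. \<forall>y \<in> K. x \<noteq> y \<longrightarrow> (x, y) \<in> parcs G)"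

definition independent_in :: "'a pair_pre_digraph \<Rightarrow> 'a set \<Rightarrow> bool" where
  "independent_in G I \<longleftrightarrow> I \<subseteq> pverts G \<and> (\<forall>x \<in> I. \<forall>y \<in> I. (x, y) \<notin> parcs G)"

text \<open>As usual for split graphs, either part of the partition may be empty.\<close>

definition split_graph :: "'a pair_pre_digraph \<Rightarrow> bool" where
  "split_graph G \<longleftrightarrow>
    (\<exists>K I. clique_in G K \<and> independent_in G I \<and> K \<union> I = pverts G \<and> K \<inter> I = {})"

text \<open>
  The contraction of the edge \<open>uv\<close> lives on the type \<open>'a option\<close>: \<open>None\<close> is the new vertex, and a
  vertex \<open>x\<close> other than \<open>u\<close> and \<open>v\<close> becomes \<open>Some x\<close>.
\<close>

definition contract_edge :: "'a pair_pre_digraph \<Rightarrow> 'a \<Rightarrow> 'a \<Rightarrow> 'a option pair_pre_digraph" where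
  "contract_edge G u v =
    (let N = (nbrs G u \<union> nbrs G v) - {u, v} in
     \<lparr> pverts = insert None (Some ` (pverts G - {u, v})),
       parcs = {(Some x, Some y) | x y. (x, y) \<in> parcs G \<and> x \<notin> {u, v} \<and> y \<notin> {u, v}}
             \<union> {(None, Some x) | x. x \<in> N} \<union> {(Some x, None) | x. x \<in> N} \<rparr>)"

text \<open>The graph on \<open>V\<close> in which every edge is listed in \<open>E\<close> in at least one orientation.\<close>

definition graph_of_edges :: "'a set \<Rightarrow> ('a \<times> 'a) set \<Rightarrow> 'a pair_pre_digraph" where
  "graph_of_edges V E = \<lparr> pverts = V, parcs = E \<union> E\<inverse> \<rparr>"

text \<open>The hub is \<open>4\<close>.\<close>

definition wheel_4 :: "nat pair_pre_digraph" where
  "wheel_4 = graph_of_edges {0..4}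
     {(0, 1), (1, 2), (2, 3), (3, 0), (4, 0), (4, 1), (4, 2), (4, 3)}"

text \<open>The parts are \<open>{0, 1}\<close>, \<open>{2, 3}\<close> and \<open>{4, 5}\<close>.\<close>

definition K_2_2_2 :: "nat pair_pre_digraph" where
  "K_2_2_2 = graph_of_edges {0..5} {(i, j). i \<le> 5 \<and> j \<le> 5 \<and> i div 2 \<noteq> j div 2}"

definition two_K_2 :: "nat pair_pre_digraph" where
  "two_K_2 = graph_of_edges {0..3} {(0, 1), (2, 3)}"

definition path_5 :: "nat pair_pre_digraph" where
  "path_5 = graph_of_edges {0..4} {(0, 1), (1, 2), (2, 3), (3, 4)}"

text \<open>The triangle \<open>0 1 2\<close> with the path \<open>2 3 4\<close> attached at \<open>2\<close>.\<close>

definition triangle_tail_2 :: "nat pair_pre_digraph" where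
  "triangle_tail_2 = graph_of_edges {0..4} {(0, 1), (1, 2), (2, 0), (2, 3), (3, 4)}"

text \<open>The shared vertex is \<open>0\<close>.\<close>

definition bowtie :: "nat pair_pre_digraph" where
  "bowtie = graph_of_edges {0..4} {(0, 1), (1, 2), (2, 0), (0, 3), (3, 4), (4, 0)}"

text \<open>
  The order of the endpoints of the contracted edge is irrelevant, and the result is again a finite
  simple graph.
\<close>

lemma contract_edge_commute: "contract_edge G u v = contract_edge G v u"
  by (simp add: contract_edge_def Un_commute insert_commute)

lemma pair_graph_contract_edge:
  assumes "pair_graph G"
  shows "pair_graph (contract_edge G u v)"
proof -
  interpret pair_graph G by fact
  let ?H = "contract_edge G u v"
  have sub: "parcs ?H \<subseteq> pverts ?H \<times> pverts ?H"
    by (auto simp: contract_edge_def nbrs_def Let_def dest: in_arcsD1 in_arcsD2)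
  have fin: "finite (pverts ?H)"
    by (simp add: contract_edge_def Let_def)
  show ?thesis
  proof unfold_locales
    show "finite (parcs ?H)"
      using finite_subset[OF sub] fin by blast
    show "symmetric (with_proj ?H)"
      unfolding symmetric_def
      by (auto simp: contract_edge_def Let_def intro!: symI dest: arcs_symmetric)
    show "fst e \<noteq> snd e" if "e \<in> parcs ?H" for e
      using that by (auto simp: contract_edge_def Let_def dest: no_loops')
  qed (use sub fin in auto)
qed

end

theory Submission
  imports Defs
begin

text \<open>
  By the theorem of Foldes and Hammer, a non-split graph contains an induced \<open>2K\<^sub>2\<close>, \<open>C\<^sub>4\<close> or \<open>C\<^sub>5\<close>.
  If all contractions are split, \<open>C\<^sub>5\<close> is impossible because contracting one of its edges leaves
  \<open>C\<^sub>4\<close>. An edge disjoint from an induced \<open>2K\<^sub>2\<close> or \<open>C\<^sub>4\<close> can be contracted without destroying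
  it, so the vertices outside the obstruction are independent and each is attached to it. Contracting
  an edge between the obstruction and an outside vertex restricts how that vertex is attached: to
  both edges of \<open>2K\<^sub>2\<close>, and to both or neither of two opposite vertices of \<open>C\<^sub>4\<close>. A second outside
  vertex of \<open>2K\<^sub>2\<close> yields a contraction with an induced \<open>C\<^sub>4\<close> or \<open>C\<^sub>5\<close>; for \<open>C\<^sub>4\<close>, replacing a
  cycle vertex by an outside vertex yields a further induced \<open>C\<^sub>4\<close> that must meet every edge.
\<close>

section \<open>Obstructions to being split, and adjacency in a contraction\<close>

definition induced_2K2 :: "'a pair_pre_digraph \<Rightarrow> 'a \<Rightarrow> 'a \<Rightarrow> 'a \<Rightarrow> 'a \<Rightarrow> bool" where
  "induced_2K2 G a b c d \<longleftrightarrow> (a, b) \<in> parcs G \<and> (c, d) \<in> parcs G \<and>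
    (a, c) \<notin> parcs G \<and> (a, d) \<notin> parcs G \<and> (b, c) \<notin> parcs G \<and> (b, d) \<notin> parcs G"

text \<open>Opposite vertices must be required to differ: with \<open>a = c\<close> the remaining
  conditions already hold on a path. For 2K2 and C5 the prescribed arcs and non-arcs force
  distinctness in a simple graph.\<close>

definition induced_C4 :: "'a pair_pre_digraph \<Rightarrow> 'a \<Rightarrow> 'a \<Rightarrow> 'a \<Rightarrow> 'a \<Rightarrow> bool" where
  "induced_C4 G a b c d \<longleftrightarrow> a \<noteq> c \<and> b \<noteq> d \<and> (a, b) \<in> parcs G \<and> (b, c) \<in> parcs G \<and>
    (c, d) \<in> parcs G \<and> (d, a) \<in> parcs G \<and> (a, c) \<notin> parcs G \<and> (b, d) \<notin> parcs G"

definition induced_C5 :: "'a pair_pre_digraph \<Rightarrow> 'a \<Rightarrow> 'a \<Rightarrow> 'a \<Rightarrow> 'a \<Rightarrow> 'a \<Rightarrow> bool" where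
  "induced_C5 G a b c d e \<longleftrightarrow> (a, b) \<in> parcs G \<and> (b, c) \<in> parcs G \<and> (c, d) \<in> parcs G \<and>
    (d, e) \<in> parcs G \<and> (e, a) \<in> parcs G \<and> (a, c) \<notin> parcs G \<and> (b, d) \<notin> parcs G \<and>
    (c, e) \<notin> parcs G \<and> (d, a) \<notin> parcs G \<and> (e, b) \<notin> parcs G"

lemma parcs_contract_edge [simp]:
  "(Some x, Some y) \<in> parcs (contract_edge G u v) \<longleftrightarrow>
    (x, y) \<in> parcs G \<and> x \<noteq> u \<and> x \<noteq> v \<and> y \<noteq> u \<and> y \<noteq> v"
  "(None, Some y) \<in> parcs (contract_edge G u v) \<longleftrightarrow>
    ((u, y) \<in> parcs G \<or> (v, y) \<in> parcs G) \<and> y \<noteq> u \<and> y \<noteq> v"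
  "(Some y, None) \<in> parcs (contract_edge G u v) \<longleftrightarrow>
    ((u, y) \<in> parcs G \<or> (v, y) \<in> parcs G) \<and> y \<noteq> u \<and> y \<noteq> v"
  "(None, None) \<notin> parcs (contract_edge G u v)"
  by (auto simp: contract_edge_def nbrs_def Let_def)

lemma pverts_contract_edge:
  "pverts (contract_edge G u v) = insert None (Some ` (pverts G - {u, v}))"
  by (simp add: contract_edge_def Let_def)

text \<open>Reduces an isomorphism onto a concrete graph on numbers to a finite adjacency table: the
  position of a vertex in \<open>xs\<close> is its image. For the concrete graphs below the table is
  settled by unfolding the bounded quantifiers.\<close>

lemma digraph_iso_nth:
  fixes G :: "'a pair_pre_digraph"
  assumes "pair_graph G" and dist: "distinct xs" and verts: "set xs = pverts G"
    and H: "pverts H = {..<length xs}" "parcs H \<subseteq> {..<length xs} \<times> {..<length xs}"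
    and adj: "\<forall>i < length xs. \<forall>j < length xs. (xs ! i, xs ! j) \<in> parcs G \<longleftrightarrow> (i, j) \<in> parcs H"
  shows "digraph_iso (with_proj G) (with_proj H)"
proof -
  interpret pair_graph G by fact
  define f where "f = the_inv_into {..<length xs} ((!) xs)"
  have inj: "inj_on ((!) xs) {..<length xs}"
    using dist by (simp add: inj_on_nth)
  have im: "(!) xs ` {..<length xs} = pverts G"
    using verts by (auto simp: set_conv_nth)
  have bij: "bij_betw f (pverts G) {..<length xs}"
    unfolding f_def using bij_betw_the_inv_into inj im by (metis bij_betw_def)
  have f_nth: "f (xs ! i) = i" if "i < length xs" for i
    unfolding f_def using the_inv_into_f_f[OF inj] that by simp
  have nth_f: "xs ! f x = x" if "x \<in> pverts G" for x
    unfolding f_def using f_the_inv_into_f[OF inj] im that by simp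
  have "parcs H = map_prod f f ` parcs G"
  proof (intro equalityI subsetI)
    fix e assume "e \<in> parcs H"
    then obtain i j where ij: "e = (i, j)" "(i, j) \<in> parcs H"
      by (cases e) auto
    then have lt: "i < length xs" "j < length xs"
      using H by auto
    then have "(xs ! i, xs ! j) \<in> parcs G"
      using adj ij by simp
    then show "e \<in> map_prod f f ` parcs G"
      using ij lt f_nth by (force intro!: image_eqI[where x = "(xs ! i, xs ! j)"])
  next
    fix e assume "e \<in> map_prod f f ` parcs G"
    then obtain x y where xy: "e = (f x, f y)" "(x, y) \<in> parcs G"
      by auto
    then have V: "x \<in> pverts G" "y \<in> pverts G"
      by (auto dest: in_arcsD1 in_arcsD2)
    then have "f x < length xs" "f y < length xs"
      using bij by (auto dest: bij_betwE)
    then show "e \<in> parcs H"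
      using adj[rule_format, of "f x" "f y"] xy V nth_f by simp
  qed
  moreover have "inj_on (map_prod f f) (parcs G)"
    by (rule inj_on_subset[of _ "pverts G \<times> pverts G"])
      (use bij in \<open>auto simp: bij_betw_def intro: map_prod_inj_on dest: in_arcsD1 in_arcsD2\<close>)
  ultimately show ?thesis
    using bij wf_digraph_axioms H unfolding digraph_iso_def
    \<comment> \<open>Arcs are pairs, so \<open>f\<close> determines the arc map, and tail and head
      remain the two projections.\<close>
    by (intro exI[of _ "\<lparr>iso_verts = f, iso_arcs = map_prod f f, iso_head = snd, iso_tail = fst\<rparr>"])
      (auto simp: pre_digraph.digraph_isomorphism_def app_iso_def with_proj_def bij_betw_def)
qed

section \<open>Split graphs: obstructions and stability under contraction\<close>

context pair_graph
begin

abbreviation adj :: "'a \<Rightarrow> 'a \<Rightarrow> bool" where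
  "adj x y \<equiv> (x, y) \<in> parcs G"

lemma adj_commute: "adj x y \<longleftrightarrow> adj y x"
  by (auto dest: arcs_symmetric)

lemma not_adj_self [simp]: "\<not> adj x x"
  by (auto dest: no_loops')

text \<open>The independent part cannot contain a whole edge, so the clique meets both edges, yet no
  arc joins them.\<close>

lemma not_split_if_induced_2K2:
  assumes "induced_2K2 G a b c d"
  shows "\<not> split_graph G"
proof
  assume "split_graph G"
  then obtain K I where K: "clique_in G K" and I: "independent_in G I" and V: "K \<union> I = pverts G"
    unfolding split_graph_def by blast
  have "{a, b, c, d} \<subseteq> pverts G"
    using assms by (auto simp: induced_2K2_def dest: in_arcsD1 in_arcsD2)
  then have "{a, b, c, d} \<subseteq> K \<union> I"
    using V by simp
  then have "a \<in> K \<or> b \<in> K" "c \<in> K \<or> d \<in> K"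
    using assms I by (auto simp: induced_2K2_def independent_in_def)
  then show False
    using assms K adj_commute unfolding induced_2K2_def clique_in_def by metis
qed

text \<open>The clique omits a vertex from each opposite pair; the two omitted vertices are
  adjacent.\<close>

lemma not_split_if_induced_C4:
  assumes "induced_C4 G a b c d"
  shows "\<not> split_graph G"
proof
  assume "split_graph G"
  then obtain K I where K: "clique_in G K" and I: "independent_in G I" and V: "K \<union> I = pverts G"
    unfolding split_graph_def by blast
  have "{a, b, c, d} \<subseteq> pverts G"
    using assms by (auto simp: induced_C4_def dest: in_arcsD1 in_arcsD2)
  then have "{a, b, c, d} \<subseteq> K \<union> I"
    using V by simp
  then have "a \<in> I \<or> c \<in> I" "b \<in> I \<or> d \<in> I"
    using assms K by (auto simp: induced_C4_def clique_in_def)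
  then show False
    using assms I adj_commute unfolding induced_C4_def independent_in_def by metis
qed

text \<open>The clique must cover the five edges, which takes three vertices, but it has at most one
  end of each of the five non-edges, which also form a 5-cycle and so allow only two.\<close>

lemma not_split_if_induced_C5:
  assumes "induced_C5 G a b c d e"
  shows "\<not> split_graph G"
proof
  assume "split_graph G"
  then obtain K I where K: "clique_in G K" and I: "independent_in G I" and V: "K \<union> I = pverts G"
    unfolding split_graph_def by blast
  have C: "adj a b" "adj b c" "adj c d" "adj d e" "adj e a"
    "\<not> adj a c" "\<not> adj b d" "\<not> adj c e" "\<not> adj d a" "\<not> adj e b"
    using assms by (auto simp: induced_C5_def)
  have sub: "{a, b, c, d, e} \<subseteq> K \<union> I"
    unfolding V using C by (auto dest: in_arcsD1 in_arcsD2)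
  have ne: "a \<noteq> c" "b \<noteq> d" "c \<noteq> e" "d \<noteq> a" "e \<noteq> b"
    using C adj_commute by metis+
  have edge: "x \<in> K \<or> y \<in> K" if "adj x y" "x \<in> K \<union> I" "y \<in> K \<union> I" for x y
    using that I by (auto simp: independent_in_def)
  have nonedge: "x \<notin> K \<or> y \<notin> K" if "\<not> adj x y" "x \<noteq> y" for x y
    using that K by (auto simp: clique_in_def)
  show False
    using edge[OF C(1)] edge[OF C(2)] edge[OF C(3)] edge[OF C(4)] edge[OF C(5)]
      nonedge[OF C(6) ne(1)] nonedge[OF C(7) ne(2)] nonedge[OF C(8) ne(3)]
      nonedge[OF C(9) ne(4)] nonedge[OF C(10) ne(5)] sub by auto
qed

lemma clique_in_insert:
  assumes "clique_in G K" "x \<in> pverts G" "\<And>v. v \<in> K \<Longrightarrow> adj x v"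
  shows "clique_in G (insert x K)"
proof -
  have "adj v x" if "v \<in> K" for v
    using assms(3)[OF that] adj_commute by simp
  then show ?thesis
    using assms unfolding clique_in_def by auto
qed

lemma clique_in_subset:
  assumes "clique_in G K" "L \<subseteq> K"
  shows "clique_in G L"
  using assms unfolding clique_in_def by auto

text \<open>
  The theorem of Foldes and Hammer. Among the maximum cliques take one, \<open>K\<close>, of maximal degree sum;
  an edge outside \<open>K\<close> would allow an exchange that increases one of the two quantities, unless one
  of the three induced subgraphs is present.
\<close>

lemma not_split_cases:
  assumes "\<not> split_graph G"
  obtains (two_K2) a b c d where "induced_2K2 G a b c d"
    | (C4) a b c d where "induced_C4 G a b c d"
    | (C5) a b c d e where "induced_C5 G a b c d e"
proof (rule ccontr)
  assume "\<not> thesis"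
  then have no: "\<not> induced_2K2 G a b c d" "\<not> induced_C4 G a b c d" "\<not> induced_C5 G a b c d e"
    for a b c d e
    using that by blast+
  have max_exists: "\<exists>L \<in> S. \<forall>M \<in> S. f M \<le> f L" if "finite S" "S \<noteq> {}"
    for S :: "'a set set" and f :: "'a set \<Rightarrow> nat"
  proof -
    have "Max (f ` S) \<in> f ` S"
      using that by simp
    then obtain L where "L \<in> S" "f L = Max (f ` S)"
      by auto
    then show ?thesis
      using that(1) by (intro bexI[of _ L]) auto
  qed
  have fin: "finite {K. clique_in G K}"
    by (rule finite_subset[of _ "Pow (pverts G)"]) (auto simp: clique_in_def)
  have "clique_in G {}"
    by (simp add: clique_in_def)
  then obtain K\<^sub>0 where K\<^sub>0: "clique_in G K\<^sub>0" "\<And>L. clique_in G L \<Longrightarrow> card L \<le> card K\<^sub>0"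
    using max_exists[OF fin, of card] by auto
  let ?M = "{K. clique_in G K \<and> card K = card K\<^sub>0}"
  let ?deg = "\<lambda>v. card (nbrs G v)"
  have "finite ?M" "?M \<noteq> {}"
    using fin K\<^sub>0 by auto
  then obtain K where K: "clique_in G K" "card K = card K\<^sub>0"
    and deg_max: "\<And>L. clique_in G L \<Longrightarrow> card L = card K\<^sub>0 \<Longrightarrow> sum ?deg L \<le> sum ?deg K"
    using max_exists[of ?M "sum ?deg"] by auto
  have finK: "finite K"
    using K by (meson clique_in_def finite_subset pair_finite_verts)
  have K_adj: "adj v w" if "v \<in> K" "w \<in> K" "v \<noteq> w" for v w
    using K(1) that unfolding clique_in_def by blast
  have card_max: "card L \<le> card K" if "clique_in G L" for L
    using K\<^sub>0 K that by simp
  have "\<not> independent_in G (pverts G - K)"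
    using assms K unfolding split_graph_def clique_in_def by blast
  then obtain x y where xy: "x \<in> pverts G - K" "y \<in> pverts G - K" "adj x y"
    by (auto simp: independent_in_def)
  have nonnbr: "\<exists>v \<in> K. \<not> adj z v" if "z \<in> pverts G - K" for z
  proof (rule ccontr)
    assume "\<not> (\<exists>v \<in> K. \<not> adj z v)"
    then have "clique_in G (insert z K)"
      using K(1) that by (intro clique_in_insert) auto
    from card_max[OF this] show False
      using that finK by simp
  qed
  \<comment> \<open>Otherwise \<open>x\<close> and \<open>y\<close> both miss exactly one vertex of
    \<open>K\<close>, the same \<open>z\<close>, and exchanging \<open>z\<close> for
    \<open>x\<close> and \<open>y\<close> enlarges the clique.\<close>
  have "\<exists>u \<in> K. \<exists>v \<in> K. u \<noteq> v \<and> \<not> adj x u \<and> \<not> adj y v"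
  proof (rule ccontr)
    assume *: "\<not> ?thesis"
    obtain z where z: "z \<in> K" "\<not> adj x z"
      using nonnbr[OF xy(1)] by blast
    have y: "adj y w" if "w \<in> K" "w \<noteq> z" for w
      using * z that by auto
    obtain w where "w \<in> K" "\<not> adj y w"
      using nonnbr[OF xy(2)] by blast
    then have "\<not> adj y z"
      using y by blast
    then have x: "adj x w" if "w \<in> K" "w \<noteq> z" for w
      using * z(1) that by auto
    have "clique_in G (insert x (insert y (K - {z})))"
      by (intro clique_in_insert clique_in_subset[OF K(1)]) (use xy x y in auto)
    from card_max[OF this] show False
      using xy finK z by (auto simp: card_insert_if no_loops')
  qed
  then obtain u v where uv: "u \<in> K" "v \<in> K" "u \<noteq> v" "\<not> adj x u" "\<not> adj y v"
    by blast
  \<comment> \<open>This is the case where exactly one of the cross pairs \<open>x v\<close> and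
    \<open>y u\<close> is an edge. It is stated for arbitrary vertices because the mirrored case
    swaps \<open>x\<close> with \<open>y\<close> and \<open>u\<close> with \<open>v\<close>. No
    cross edge gives 2K2, two give C4.\<close>
  have impossible: False
    if xy: "x \<in> pverts G - K" "y \<in> pverts G - K" "adj x y"
      and uv: "u \<in> K" "v \<in> K" "u \<noteq> v" "\<not> adj x u" "\<not> adj y v"
      and xv: "\<not> adj x v" and yu: "adj y u" for x y u v
  proof -
    \<comment> \<open>A second non-neighbour \<open>w\<close> of \<open>y\<close> in
      \<open>K\<close> gives the 2K2 \<open>x y\<close>, \<open>v w\<close> if \<open>x\<close>
      misses \<open>w\<close>, and the C4 \<open>x y u w\<close> otherwise.\<close>
    have y_adj: "adj y w" if w: "w \<in> K" "w \<noteq> v" for w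
    proof (rule ccontr)
      assume "\<not> adj y w"
      moreover from this have "u \<noteq> w"
        using yu by auto
      ultimately show False
        using no(1)[of x y v w] no(2)[of x y u w] xy uv xv yu w K_adj[of v w] K_adj[of u w]
          adj_commute[of w x] by (auto simp: induced_2K2_def induced_C4_def)
    qed
    \<comment> \<open>Exchanging \<open>v\<close> for \<open>y\<close> gives another maximum clique,
      so the maximal degree sum yields that \<open>y\<close> has degree at most that of
      \<open>v\<close>.\<close>
    let ?L = "insert y (K - {v})"
    have "clique_in G ?L"
      by (intro clique_in_insert clique_in_subset[OF K(1)]) (use xy y_adj in auto)
    moreover have "card ?L = card K\<^sub>0"
      using card_Suc_Diff1[OF finK uv(2)] K finK xy by simp
    ultimately have "sum ?deg ?L \<le> sum ?deg K"
      using deg_max by blast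
    moreover have "sum ?deg ?L = ?deg y + sum ?deg (K - {v})"
      using finK xy by simp
    moreover have "sum ?deg K = ?deg v + sum ?deg (K - {v})"
      using sum.remove[OF finK uv(2)] by simp
    ultimately have "?deg y \<le> ?deg v"
      by simp
    moreover have "finite (nbrs G z)" for z
      by (rule finite_subset[of _ "pverts G"]) (auto simp: nbrs_def dest: in_arcsD2)
    moreover have "x \<in> nbrs G y" "x \<notin> nbrs G v"
      using xy xv adj_commute by (auto simp: nbrs_def)
    \<comment> \<open>An inclusion would be an equality by the degree bound, but \<open>x\<close> is
      a neighbour of \<open>y\<close> only.\<close>
    ultimately have "\<not> nbrs G v \<subseteq> nbrs G y"
      by (metis card_seteq)
    then obtain t where t: "adj v t" "\<not> adj y t"
      by (auto simp: nbrs_def)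
    then have "adj x t"
      using no(1)[of x y v t] xy uv xv by (auto simp: induced_2K2_def)
    moreover have "x \<noteq> u" "y \<noteq> t"
      using uv yu xy xv \<open>adj x t\<close> t adj_commute[of y v] by auto
    \<comment> \<open>The vertices \<open>x y u t\<close> form a C4 if \<open>u\<close> and
      \<open>t\<close> are adjacent; otherwise \<open>x y u v t\<close> form a C5.\<close>
    ultimately show False
      using no(2)[of x y u t] no(3)[of x y u v t] xy uv xv yu t K_adj[of u v]
        adj_commute[of t x] adj_commute[of t y] adj_commute[of t u] adj_commute[of v x]
      by (auto simp: induced_C4_def induced_C5_def)
  qed
  have "\<not> (\<not> adj x v \<and> \<not> adj y u)"
    using no(1)[of x y u v] xy uv K_adj by (auto simp: induced_2K2_def)
  moreover have "\<not> (adj x v \<and> adj y u)"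
    using no(2)[of x y u v] xy uv K_adj[of u v] adj_commute[of v x] by (auto simp: induced_C4_def)
  ultimately show False
    using impossible[OF xy uv] impossible[of y x v u] xy uv adj_commute[of y x] by blast
qed

text \<open>One end of the edge lies in the clique, and the new vertex inherits its neighbours
  there, so it can join the clique part.\<close>

lemma split_graph_contract_edge:
  assumes "split_graph G" and uv: "adj u v"
  shows "split_graph (contract_edge G u v)"
proof -
  obtain K I where K: "clique_in G K" and I: "independent_in G I"
    and V: "K \<union> I = pverts G" "K \<inter> I = {}"
    using assms unfolding split_graph_def by blast
  have sub: "K \<subseteq> pverts G" "I \<subseteq> pverts G"
    using K I by (auto simp: clique_in_def independent_in_def)
  have "u \<in> pverts G" "v \<in> pverts G"
    using uv by (auto dest: in_arcsD1 in_arcsD2)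
  then have "u \<in> K \<union> I" "v \<in> K \<union> I"
    using V(1) by simp_all
  moreover have "\<not> (u \<in> I \<and> v \<in> I)"
    using uv I by (auto simp: independent_in_def)
  ultimately have "u \<in> K \<or> v \<in> K"
    by auto
  then have "adj u x \<or> adj v x" if "x \<in> K" "x \<noteq> u" "x \<noteq> v" for x
    using that K unfolding clique_in_def by metis
  then have "clique_in (contract_edge G u v) (insert None (Some ` (K - {u, v})))"
    using K sub by (auto simp: clique_in_def pverts_contract_edge)
  moreover have "independent_in (contract_edge G u v) (Some ` (I - {u, v}))"
    using I sub by (auto simp: independent_in_def pverts_contract_edge)
  moreover have "insert None (Some ` (K - {u, v})) \<union> Some ` (I - {u, v})
      = pverts (contract_edge G u v)"
    using V by (auto simp: pverts_contract_edge)
  moreover have "insert None (Some ` (K - {u, v})) \<inter> Some ` (I - {u, v}) = {}"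
    using V by auto
  ultimately show ?thesis
    unfolding split_graph_def by blast
qed

end

section \<open>Graphs all of whose contractions are split\<close>

locale contractions_split = pair_graph +
  assumes no_isolated: "no_isolated_vertices G"
    and split_contract: "adj u v \<Longrightarrow> split_graph (contract_edge G u v)"
begin

lemma no_obstruction_contract_edge:
  assumes "adj u v"
  shows "\<not> induced_2K2 (contract_edge G u v) a b c d"
    and "\<not> induced_C4 (contract_edge G u v) a b c d"
    and "\<not> induced_C5 (contract_edge G u v) a b c d e"
  using split_contract[OF assms] pair_graph_contract_edge[OF pair_graph]
    pair_graph.not_split_if_induced_2K2 pair_graph.not_split_if_induced_C4
    pair_graph.not_split_if_induced_C5 by metis+

lemma no_induced_C5: "\<not> induced_C5 G a b c d e"
proof
  assume C5: "induced_C5 G a b c d e"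
  then have "induced_C4 (contract_edge G a b) None (Some c) (Some d) (Some e)"
    using adj_commute not_adj_self unfolding induced_C4_def induced_C5_def parcs_contract_edge
    by (metis option.distinct(1) option.inject)
  then show False
    using no_obstruction_contract_edge C5 by (auto simp: induced_C5_def)
qed

section \<open>The case of an induced 2K2\<close>

lemma induced_2K2_cases:
  assumes "induced_2K2 G a b c d"
  shows "digraph_iso (with_proj G) (with_proj two_K_2) \<or>
    digraph_iso (with_proj G) (with_proj path_5) \<or>
    digraph_iso (with_proj G) (with_proj triangle_tail_2) \<or>
    digraph_iso (with_proj G) (with_proj bowtie)"
proof -
  have E: "adj a b" "adj b a" "adj c d" "adj d c"
    and N: "\<not> adj a c" "\<not> adj a d" "\<not> adj b c" "\<not> adj b d"
      "\<not> adj c a" "\<not> adj d a" "\<not> adj c b" "\<not> adj d b"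
    using assms adj_commute by (auto simp: induced_2K2_def)
  have ne: "a \<noteq> b" "a \<noteq> c" "a \<noteq> d" "b \<noteq> c" "b \<noteq> d" "c \<noteq> d"
    using E N by auto
  have V: "{a, b, c, d} \<subseteq> pverts G"
    using E by (auto dest: in_arcsD1)
  have indep: "\<not> adj v w" if "v \<notin> {a, b, c, d}" "w \<notin> {a, b, c, d}" for v w
    using no_obstruction_contract_edge(1)[of v w "Some a" "Some b" "Some c" "Some d"] E N that
    by (auto simp: induced_2K2_def)
  \<comment> \<open>If \<open>v\<close> missed \<open>r\<close> and \<open>s\<close>, then after
    contracting \<open>v p\<close> the new vertex would replace \<open>p\<close> in the 2K2.\<close>
  have other_edge: "adj v r \<or> adj v s"
    if "adj v p" "induced_2K2 G p q r s" "v \<notin> {p, q, r, s}" for v p q r s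
    using no_obstruction_contract_edge(1)[of v p None "Some q" "Some r" "Some s"] that
    using adj_commute not_adj_self unfolding induced_2K2_def parcs_contract_edge by (metis insertCI)
  have meets: "(adj v a \<or> adj v b) \<and> (adj v c \<or> adj v d)"
    if v: "v \<in> pverts G" "v \<notin> {a, b, c, d}" for v
  proof -
    obtain w where "adj v w"
      using no_isolated v by (auto simp: no_isolated_vertices_def nbrs_def)
    moreover then have "w \<in> {a, b, c, d}"
      using indep v by blast
    ultimately show ?thesis
      using other_edge[of v a b c d] other_edge[of v b a c d] other_edge[of v c d a b]
        other_edge[of v d c a b] v E N by (auto simp: induced_2K2_def)
  qed
  \<comment> \<open>Contracting \<open>p q\<close> makes the new vertex adjacent to \<open>v\<close>
    and \<open>w\<close>, but not to \<open>r\<close>, so a common neighbour \<open>r\<close> closes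
    an induced C4.\<close>
  have no_common: "\<not> (adj v r \<and> adj w r)"
    if "adj p q" "\<not> adj p r" "\<not> adj q r" "r \<noteq> p" "r \<noteq> q"
      "v \<noteq> w" "v \<notin> {p, q}" "w \<notin> {p, q}" "\<not> adj v w"
      "adj v p \<or> adj v q" "adj w p \<or> adj w q" for p q r v w
    using no_obstruction_contract_edge(2)[of p q None "Some v" "Some r" "Some w"] that
    using adj_commute unfolding induced_C4_def parcs_contract_edge
    by (metis insertCI option.distinct(1) option.inject)
  \<comment> \<open>The hypotheses describe an induced 6-cycle \<open>v p q w s r\<close>;
    contracting its edge \<open>v p\<close> leaves an induced C5.\<close>
  have hexagon: False
    if "adj v p" "adj p q" "adj q w" "adj w s" "adj s r" "adj r v"
      "\<not> adj v q" "\<not> adj v w" "\<not> adj v s" "\<not> adj p w" "\<not> adj p s" "\<not> adj p r"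
      "\<not> adj q s" "\<not> adj q r" "\<not> adj w r" for p q r s v w
  proof -
    have "induced_C5 (contract_edge G v p) None (Some q) (Some w) (Some s) (Some r)"
      using that adj_commute not_adj_self unfolding induced_C5_def parcs_contract_edge by metis
    then show False
      using no_obstruction_contract_edge(3) that(1) by blast
  qed
  have unique: "v = w"
    if v: "v \<in> pverts G" "v \<notin> {a, b, c, d}" and w: "w \<in> pverts G" "w \<notin> {a, b, c, d}" for v w
  proof (rule ccontr)
    assume "v \<noteq> w"
    have nvw: "\<not> adj v w" "\<not> adj w v"
      using indep v w by auto
    note * = E N ne v w meets nvw \<open>v \<noteq> w\<close>
    have "\<not> (adj v c \<and> adj w c)" "\<not> (adj v d \<and> adj w d)"
      using no_common[of a b c v w] no_common[of a b d v w] * by blast+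
    moreover have "\<not> (adj v a \<and> adj w a)" "\<not> (adj v b \<and> adj w b)"
      using no_common[of c d a v w] no_common[of c d b v w] * by blast+
    \<comment> \<open>Both vertices meet both edges but share no neighbour, so each takes one end of
      each edge. Every such choice makes the six vertices an induced hexagon.\<close>
    ultimately have "(adj v a \<and> adj w b \<and> \<not> adj v b \<and> \<not> adj w a \<or>
        adj v b \<and> adj w a \<and> \<not> adj v a \<and> \<not> adj w b) \<and>
      (adj v c \<and> adj w d \<and> \<not> adj v d \<and> \<not> adj w c \<or>
        adj v d \<and> adj w c \<and> \<not> adj v c \<and> \<not> adj w d)"
      using meets[OF v] meets[OF w] by blast
    then show False
      using hexagon[of v a b w d c] hexagon[of v a b w c d] hexagon[of v b a w d c]
        hexagon[of v b a w c d] E N nvw adj_commute by metis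
  qed
  have iso: "digraph_iso (with_proj G) (with_proj path_5) \<or>
      digraph_iso (with_proj G) (with_proj triangle_tail_2)"
    if "induced_2K2 G p q r s" "pverts G = {p, q, r, s, v}" "v \<notin> {p, q, r, s}"
      "adj v q" "adj v r" "\<not> adj v s" for p q r s v
  proof -
    have A: "adj p q" "adj q p" "adj r s" "adj s r" "adj v q" "adj q v" "adj v r" "adj r v"
        "\<not> adj p r" "\<not> adj p s" "\<not> adj q r" "\<not> adj q s" "\<not> adj v s"
        "\<not> adj r p" "\<not> adj s p" "\<not> adj r q" "\<not> adj s q" "\<not> adj s v"
      using that adj_commute by (auto simp: induced_2K2_def)
    \<comment> \<open>In this order the graph is the path \<open>p q v r s\<close>; the possible
      further edge \<open>v p\<close> closes the triangle that carries the tail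
      \<open>v r s\<close>.\<close>
    then have d: "distinct [p, q, v, r, s]"
      using that(3) by auto
    show ?thesis
    proof (cases "adj v p")
      case True
      then have "adj p v"
        using adj_commute by blast
      have "digraph_iso (with_proj G) (with_proj triangle_tail_2)"
        by (rule digraph_iso_nth[OF pair_graph d])
          (use A True \<open>adj p v\<close> that(2) in
            \<open>auto simp: triangle_tail_2_def graph_of_edges_def All_less_Suc\<close>)
      then show ?thesis ..
    next
      case False
      then have "\<not> adj p v"
        using adj_commute by blast
      have "digraph_iso (with_proj G) (with_proj path_5)"
        by (rule digraph_iso_nth[OF pair_graph d])
          (use A False \<open>\<not> adj p v\<close> that(2) in
            \<open>auto simp: path_5_def graph_of_edges_def All_less_Suc\<close>)
      then show ?thesis ..
    qed
  qed
  show ?thesis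
  proof (cases "pverts G = {a, b, c, d}")
    case True
    have "digraph_iso (with_proj G) (with_proj two_K_2)"
      by (rule digraph_iso_nth[OF pair_graph, where xs = "[a, b, c, d]"])
        (use E N ne True in
            \<open>auto simp: two_K_2_def graph_of_edges_def All_less_Suc\<close>)
    then show ?thesis ..
  next
    case False
    then obtain v where v: "v \<in> pverts G" "v \<notin> {a, b, c, d}"
      using V by blast
    then have verts: "pverts G = {a, b, c, d, v}"
      using V unique by blast
    show ?thesis
    proof (cases "adj v a \<and> adj v b \<and> adj v c \<and> adj v d")
      case True
      moreover from True have "adj a v" "adj b v" "adj c v" "adj d v"
        using adj_commute by blast+
      ultimately have "digraph_iso (with_proj G) (with_proj bowtie)"
        by (intro digraph_iso_nth[OF pair_graph, where xs = "[v, a, b, c, d]"])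
          (use E N ne v verts in
            \<open>auto simp: bowtie_def graph_of_edges_def All_less_Suc\<close>)
      then show ?thesis by blast
    next
      case False
      \<comment> \<open>Relabel so that \<open>s\<close> is a vertex missed by \<open>v\<close>;
        then \<open>v\<close> must see \<open>r\<close>. Swapping \<open>p\<close> and
        \<open>q\<close> afterwards, if needed, makes \<open>v\<close> see \<open>q\<close>.\<close>
      have "\<exists>p q r s. induced_2K2 G p q r s \<and> {p, q, r, s} = {a, b, c, d} \<and>
          (adj v p \<or> adj v q) \<and> adj v r \<and> \<not> adj v s"
      proof -
        have "induced_2K2 G a b c d" "induced_2K2 G a b d c" "induced_2K2 G c d a b"
          "induced_2K2 G c d b a"
          using E N by (auto simp: induced_2K2_def)
        moreover have "{a, b, d, c} = {a, b, c, d}" "{c, d, a, b} = {a, b, c, d}"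
          "{c, d, b, a} = {a, b, c, d}"
          by auto
        ultimately show ?thesis
          using meets[OF v] False by metis
      qed
      then obtain p q r s where pqrs: "induced_2K2 G p q r s" "{p, q, r, s} = {a, b, c, d}"
          "adj v p \<or> adj v q" "adj v r" "\<not> adj v s"
        by blast
      have "induced_2K2 G q p r s" "{q, p, r, s} = {a, b, c, d}"
        using pqrs adj_commute by (auto simp: induced_2K2_def)
      then have "\<exists>p q r s. induced_2K2 G p q r s \<and> {p, q, r, s} = {a, b, c, d} \<and>
          adj v q \<and> adj v r \<and> \<not> adj v s"
        using pqrs by blast
      then obtain p q r s where "induced_2K2 G p q r s" "{p, q, r, s} = {a, b, c, d}"
          "adj v q" "adj v r" "\<not> adj v s"
        by blast
      moreover then have "pverts G = {p, q, r, s, v}" "v \<notin> {p, q, r, s}"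
        using verts v by blast+
      ultimately show ?thesis
        using iso by blast
    qed
  qed
qed

section \<open>The case of an induced C4\<close>

lemma induced_C4_cases:
  assumes "induced_C4 G a b c d"
  shows "(\<exists>m \<ge> 2. complete_bipartite_digraph 2 m (with_proj G)) \<or>
    digraph_iso (with_proj G) (with_proj wheel_4) \<or>
    digraph_iso (with_proj G) (with_proj K_2_2_2)"
proof -
  have E: "adj a b" "adj b a" "adj b c" "adj c b" "adj c d" "adj d c" "adj d a" "adj a d"
    and N: "\<not> adj a c" "\<not> adj c a" "\<not> adj b d" "\<not> adj d b"
    and ne: "a \<noteq> b" "a \<noteq> c" "a \<noteq> d" "b \<noteq> c" "b \<noteq> d" "c \<noteq> d"
    using assms adj_commute by (auto simp: induced_C4_def)
  have V: "{a, b, c, d} \<subseteq> pverts G"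
    using E by (auto dest: in_arcsD1)
  \<comment> \<open>Stated for any induced 4-cycle, since it is applied below to cycles through
    vertices of \<open>R\<close>.\<close>
  have disjoint_edge: "\<not> adj v w"
    if "induced_C4 G p q r s" "v \<notin> {p, q, r, s}" "w \<notin> {p, q, r, s}" for p q r s v w
    using no_obstruction_contract_edge(2)[of v w "Some p" "Some q" "Some r" "Some s"] that
    by (auto simp: induced_C4_def)
  \<comment> \<open>If \<open>v\<close> missed \<open>r\<close>, then after contracting
    \<open>v p\<close> the new vertex would replace \<open>p\<close> in the cycle.\<close>
  have opposite: "adj v r" if "adj v p" "induced_C4 G p q r s" "v \<notin> {p, q, r, s}" for v p q r s
    using no_obstruction_contract_edge(2)[of v p None "Some q" "Some r" "Some s"] that
    using adj_commute not_adj_self unfolding induced_C4_def parcs_contract_edge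
    by (metis insertCI option.distinct(1) option.inject)
  define R where "R = pverts G - {a, b, c, d}"
  have opp: "adj v a \<longleftrightarrow> adj v c" "adj v b \<longleftrightarrow> adj v d" if "v \<in> R" for v
    using opposite[of v a b c d] opposite[of v c d a b] opposite[of v b c d a]
      opposite[of v d a b c] that E N ne by (auto simp: induced_C4_def R_def)
  have some: "adj v a \<or> adj v b" if v: "v \<in> R" for v
  proof -
    obtain w where "adj v w"
      using no_isolated v by (auto simp: no_isolated_vertices_def nbrs_def R_def)
    moreover then have "w \<in> {a, b, c, d}"
      using disjoint_edge[OF assms, of v w] v in_arcsD2 by (auto simp: R_def)
    ultimately show ?thesis
      using opp[OF v] by blast
  qed
  \<comment> \<open>Here \<open>v\<close> sees \<open>a\<close> and \<open>c\<close> only, so it can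
    replace \<open>d\<close>: the induced cycle \<open>a v c b\<close> is disjoint from the edge
    \<open>w d\<close>. In the mirrored version below, \<open>v\<close> replaces
    \<open>c\<close>.\<close>
  have mixed: False if "v \<in> R" "w \<in> R" "v \<noteq> w" "adj v a" "\<not> adj v b" "adj w b" for v w
    using disjoint_edge[of a v c b w d] that opp[of v] opp[of w] E N ne adj_commute
    by (auto simp: induced_C4_def R_def)
  have mixed': False if "v \<in> R" "w \<in> R" "v \<noteq> w" "adj v b" "\<not> adj v a" "adj w a" for v w
    using disjoint_edge[of b v d a w c] that opp[of v] opp[of w] E N ne adj_commute
    by (auto simp: induced_C4_def R_def)
  \<comment> \<open>The small part is \<open>{p, r}\<close>. All other vertices are independent and
    adjacent to both; \<open>q\<close> and \<open>s\<close> guarantee that there are at least two of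
    them.\<close>
  have biclique: "\<exists>m \<ge> 2. complete_bipartite_digraph 2 m (with_proj G)"
    if C4: "induced_C4 G p q r s" and pqrs: "{p, q, r, s} = {a, b, c, d}"
      and R_adj: "\<And>v. v \<in> R \<Longrightarrow> adj v p \<and> adj v r \<and> \<not> adj v q \<and> \<not> adj v s" for p q r s
  proof -
    let ?W = "pverts G - {p, r}"
    have V': "p \<in> pverts G" "q \<in> pverts G" "r \<in> pverts G" "s \<in> pverts G"
      using C4 by (auto simp: induced_C4_def dest: in_arcsD1)
    have ne': "p \<noteq> q" "p \<noteq> r" "p \<noteq> s" "q \<noteq> r" "q \<noteq> s" "r \<noteq> s"
      using C4 by (auto simp: induced_C4_def)
    have W: "x = q \<or> x = s \<or> x \<in> R" if "x \<in> ?W" for x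
      using that pqrs by (auto simp: R_def)
    have pr: "adj x p" "adj x r" if "x \<in> ?W" for x
      using W[OF that] R_adj C4 adj_commute by (auto simp: induced_C4_def)
    have WW: "\<not> adj x y" if "x \<in> ?W" "y \<in> ?W" for x y
      using W[OF that(1)] W[OF that(2)] R_adj C4 adj_commute disjoint_edge[OF assms, of x y]
      by (auto simp: induced_C4_def R_def)
    have nonadj: "\<not> adj p r" "\<not> adj r p"
      using C4 adj_commute[of p r] by (simp_all add: induced_C4_def)
    have pp: "\<not> adj x y" if "x \<in> {p, r}" "y \<in> {p, r}" for x y
      using that nonadj by auto
    have pW: "adj x y" "adj y x" if "x \<in> {p, r}" "y \<in> ?W" for x y
      using that(1) pr[OF that(2)] adj_commute[of y x] by auto
    have arcs: "parcs G = {p, r} \<times> ?W \<union> ?W \<times> {p, r}"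
    proof (intro equalityI subrelI)
      fix x y assume xy: "adj x y"
      then have "x \<in> pverts G" "y \<in> pverts G"
        using in_arcsD1 in_arcsD2 by simp_all
      then show "(x, y) \<in> {p, r} \<times> ?W \<union> ?W \<times> {p, r}"
        using xy pp[of x y] WW[of x y] by auto
    next
      fix x y assume "(x, y) \<in> {p, r} \<times> ?W \<union> ?W \<times> {p, r}"
      then show "adj x y"
        using pW[of x y] pW[of y x] unfolding Un_iff mem_Sigma_iff by argo
    qed
    have verts: "pverts G = {p, r} \<union> ?W" "{p, r} \<inter> ?W = {}"
      using V' by auto
    have card: "card {p, r} = 2"
      using ne' by simp
    have K: "complete_bipartite_digraph 2 (card ?W) (with_proj G)"
      unfolding complete_bipartite_digraph_pair_def
      by (rule conjI[OF pair_finite_verts], rule exI[of _ "{p, r}"], rule exI[of _ ?W],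
        intro conjI arcs verts card refl)
    have "card {q, s} \<le> card ?W"
      by (rule card_mono) (use V' ne' in auto)
    then have "2 \<le> card ?W"
      using ne' by simp
    with K show ?thesis
      by blast
  qed
  have C4': "induced_C4 G b c d a"
    using E N ne by (auto simp: induced_C4_def)
  \<comment> \<open>If some vertex of \<open>R\<close> sees \<open>a\<close> and some vertex sees
    \<open>b\<close>, then \<open>mixed\<close> makes one of them see both. An empty
    \<open>R\<close> falls under the first case and gives the 4-cycle itself as the complete
    bipartite graph.\<close>
  consider "\<And>v. v \<in> R \<Longrightarrow> \<not> adj v b" | "\<And>v. v \<in> R \<Longrightarrow> \<not> adj v a"
    | z where "z \<in> R" "adj z a" "adj z b"
    using some mixed by metis
  then show ?thesis
  proof cases
    case 1
    then show ?thesis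
      using biclique[OF assms] opp some by blast
  next
    case 2
    then have "\<exists>m \<ge> 2. complete_bipartite_digraph 2 m (with_proj G)"
      by (intro biclique[OF C4']) (use opp some in auto)
    then show ?thesis ..
  next
    case z: 3
    \<comment> \<open>A vertex of \<open>R\<close> attached to only one opposite pair would
      contradict \<open>mixed\<close> or \<open>mixed'\<close> together with
      \<open>z\<close>.\<close>
    have all: "adj w a" "adj w b" "adj w c" "adj w d" "adj a w" "adj b w" "adj c w" "adj d w"
      if "w \<in> R" for w
      using mixed[of w z] mixed'[of w z] some[OF that] opp[OF that] z that adj_commute by metis+
    show ?thesis
    proof (cases "R = {z}")
      case True
      then have "pverts G = {a, b, c, d, z}"
        using V by (auto simp: R_def)
      then have "digraph_iso (with_proj G) (with_proj wheel_4)"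
        by (intro digraph_iso_nth[OF pair_graph, where xs = "[a, b, c, d, z]"])
          (use E N ne z all[OF z(1)] in
            \<open>auto simp: R_def wheel_4_def graph_of_edges_def All_less_Suc\<close>)
      then show ?thesis by blast
    next
      case False
      then obtain w where w: "w \<in> R" "w \<noteq> z"
        using z by blast
      have nzw: "\<not> adj z w" "\<not> adj w z"
        using disjoint_edge[OF assms] z w by (auto simp: R_def)
      \<comment> \<open>The cycle \<open>a z c w\<close> is induced as well, and a third vertex
        \<open>t\<close> would give the edge \<open>t b\<close> disjoint from it.\<close>
      have "t = z \<or> t = w" if "t \<in> R" for t
        using disjoint_edge[of a z c w t b] nzw all[OF w(1)] all[OF z(1)] all[OF that] w z(1) that ne N
        by (auto simp: R_def induced_C4_def)
      then have "pverts G = {a, c, b, d, z, w}"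
        using V w z by (auto simp: R_def)
      \<comment> \<open>The list puts the three non-adjacent pairs in consecutive positions,
        matching the parts given by \<open>i div 2\<close>.\<close>
      then have "digraph_iso (with_proj G) (with_proj K_2_2_2)"
        by (intro digraph_iso_nth[OF pair_graph, where xs = "[a, c, b, d, z, w]"])
          (use E N ne z(1) w nzw all[OF z(1)] all[OF w(1)] in
            \<open>auto simp: R_def K_2_2_2_def graph_of_edges_def All_less_Suc\<close>)
      then show ?thesis by blast
    qed
  qed
qed

end

theorem theorem38:
  fixes G :: "'a pair_pre_digraph"
  assumes "pair_graph G"
    and "no_isolated_vertices G"
    and "\<And>m. m \<ge> 2 \<Longrightarrow> \<not> complete_bipartite_digraph 2 m (with_proj G)"
    and "\<not> digraph_iso (with_proj G) (with_proj wheel_4)"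
    and "\<not> digraph_iso (with_proj G) (with_proj K_2_2_2)"
    and "\<not> digraph_iso (with_proj G) (with_proj two_K_2)"
    and "\<not> digraph_iso (with_proj G) (with_proj path_5)"
    and "\<not> digraph_iso (with_proj G) (with_proj triangle_tail_2)"
    and "\<not> digraph_iso (with_proj G) (with_proj bowtie)"
  shows "split_graph G \<longleftrightarrow> (\<forall>(u, v) \<in> parcs G. split_graph (contract_edge G u v))"
proof
  assume "split_graph G"
  then show "\<forall>(u, v) \<in> parcs G. split_graph (contract_edge G u v)"
    using pair_graph.split_graph_contract_edge[OF assms(1)] by blast
next
  assume "\<forall>(u, v) \<in> parcs G. split_graph (contract_edge G u v)"
  then interpret contractions_split G
    using assms(1,2) by (intro contractions_split.intro contractions_split_axioms.intro) auto
  show "split_graph G"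
    \<comment> \<open>A non-split \<open>G\<close> contains one of the three obstructions; C5 is
      impossible and the other two lead to one of the excluded graphs.\<close>
    using not_split_cases induced_2K2_cases induced_C4_cases no_induced_C5 assms(3-) by metis
qed

end
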